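(* Let $n\ge1$. There is a bijection between the set of permutations $\pi\in S_n$ satisfying $\pi(i)\ge i-1$ for all $i\in\{2,\dots,n\}$ and the set of compositions of $n$ which matches the cycle sizes of permutations to the part sizes of compositions; that is, for every $k\ge1$, the number of $k$-cycles of $\pi$ equals the number of parts equal to $k$ in the composition corresponding to $\pi$.
   Context: $S_n$ is the symmetric group on $\{1,\dots,n\}$. A $k$-cycle of a permutation is a cycle of length $k$ in its disjoint cycle decomposition, with fixed points counted as $1$-cycles. A composition of $n$ is an ordered list of positive integers (its parts) whose sum is $n$. *)

theory Defs
  imports "HOL-Combinatorics.Orbits"
begin

(* A cycle of p is represented by its underlying set, an orbit of p, so that distinct
   fixed points give distinct 1-cycles {x}.  Here S is the ground set: elements outside
   S, which are fixed by any p that permutes S, contribute no cycles. *)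
definition cycles_on :: "'a set \<Rightarrow> ('a \<Rightarrow> 'a) \<Rightarrow> 'a set set" where
  "cycles_on S p = {C. C \<subseteq> S \<and> cyclic_on p C}"

definition num_cycles :: "'a set \<Rightarrow> ('a \<Rightarrow> 'a) \<Rightarrow> nat \<Rightarrow> nat" where
  "num_cycles S p k = card {C \<in> cycles_on S p. card C = k}"

lemma cycles_on_eq_orbits:
  assumes "finite S" "p permutes S"
  shows "cycles_on S p = orbit p ` S"
proof -
  have perm: "permutation p"
    using assms permutation_permutes by blast
  have sub: "orbit p x \<subseteq> S" if "x \<in> S" for x
    using permutes_orbit_subset[OF assms(2) that] .
  have self: "x \<in> orbit p x" for x
    by (rule permutation_self_in_orbit[OF perm])
  show ?thesis
  proof (intro equalityI subsetI)
    fix C assume "C \<in> cycles_on S p"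
    then show "C \<in> orbit p ` S"
      by (auto simp: cycles_on_def cyclic_on_def)
  next
    fix C assume "C \<in> orbit p ` S"
    then show "C \<in> cycles_on S p"
      using sub self by (force simp: cycles_on_def cyclic_on_def)
  qed
qed

definition compositions :: "nat \<Rightarrow> nat list set" where
  "compositions n = {c. (\<forall>a\<in>set c. a \<ge> 1) \<and> sum_list c = n}"

end

theory Submission
  imports Defs
begin

text \<open>
  A permutation satisfying \<open>\<pi> i \<ge> i - 1\<close> can only descend in steps of size one, so in order to
  return from the maximum \<open>b\<close> of a cycle to its minimum \<open>a\<close> it must pass through every
  intermediate point. It can never jump back up on the way, because the points above the current
  one have already been visited. Every cycle therefore has the form \<open>a \<mapsto> b \<mapsto> b - 1 \<mapsto> \<dots> \<mapsto> a + 1 \<mapsto> a\<close> on an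
  interval, and \<open>\<pi>\<close> is determined by the way in which these intervals cut up \<open>{1..n}\<close>. Reading off
  the interval lengths from left to right gives a composition of \<open>n\<close>.

  It is easier to build the map in the opposite direction: \<open>composition_perm\<close> turns a composition
  into the product of the rotations of consecutive intervals. Its cycles are these intervals
  (\<open>num_cycles_composition_perm\<close>), the length of the first one can be recovered from the image of
  the least point (\<open>composition_perm_inj\<close>), and every permutation with unit descents arises in this
  way, since the cycle of the least point can be split off (\<open>unit_descents_first_cycle\<close>,
  \<open>composition_perm_surj\<close>). The required bijection is the inverse of this map.
\<close>

section \<open>Rotations of intervals\<close>

definition rotate_down :: "nat \<Rightarrow> nat \<Rightarrow> nat \<Rightarrow> nat" where
  "rotate_down a k x =
     (if x = a then a + k - 1 else if x \<in> {a<..<a + k} then x - 1 else x)"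

lemma rotate_down_outside: "k \<ge> 1 \<Longrightarrow> x \<notin> {a..<a + k} \<Longrightarrow> rotate_down a k x = x"
  by (auto simp: rotate_down_def)

lemma rotate_down_permutes:
  assumes "k \<ge> 1"
  shows "rotate_down a k permutes {a..<a + k}"
proof (rule bij_imp_permutes)
  have "inj_on (rotate_down a k) {a..<a + k}"
    by (auto simp: inj_on_def rotate_down_def split: if_splits)
  moreover have "rotate_down a k ` {a..<a + k} \<subseteq> {a..<a + k}"
    using assms by (auto simp: rotate_down_def)
  ultimately show "bij_betw (rotate_down a k) {a..<a + k} {a..<a + k}"
    by (simp add: bij_betw_def endo_inj_surj)
qed (use assms in \<open>simp add: rotate_down_outside\<close>)

text \<open>Starting at \<open>a\<close>, the orbit jumps to the top of the interval and then walks down through all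
  of its points.\<close>

lemma rotate_down_cyclic:
  assumes "k \<ge> 1"
  shows "cyclic_on (rotate_down a k) {a..<a + k}"
proof -
  let ?r = "rotate_down a k"
  have "a + k - 1 - j \<in> orbit ?r a" if "j < k" for j
    using that
  proof (induction j)
    case 0
    have "?r a = a + k - 1 - 0"
      by (simp add: rotate_down_def)
    then show ?case
      using orbit.base[of ?r a] by simp
  next
    case (Suc j)
    then have "?r (a + k - 1 - j) \<in> orbit ?r a"
      by (intro orbit.step) simp
    moreover have "?r (a + k - 1 - j) = a + k - 1 - Suc j"
      using Suc.prems by (auto simp: rotate_down_def)
    ultimately show ?case
      by simp
  qed
  note reach = this
  have "x \<in> orbit ?r a" if "x \<in> {a..<a + k}" for x
  proof -
    have "a + k - 1 - x < k" "a + k - 1 - (a + k - 1 - x) = x"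
      using that assms by auto
    then show ?thesis
      using reach[of "a + k - 1 - x"] by simp
  qed
  moreover have "orbit ?r a \<subseteq> {a..<a + k}"
    using assms by (intro permutes_orbit_subset[OF rotate_down_permutes]) auto
  ultimately have "orbit ?r a = {a..<a + k}"
    by blast
  then show ?thesis
    using assms by (auto simp: cyclic_on_def)
qed

section \<open>Cycles of a permutation preserving two disjoint sets\<close>

lemma cycles_on_cong: "(\<And>x. x \<in> S \<Longrightarrow> p x = q x) \<Longrightarrow> cycles_on S p = cycles_on S q"
  unfolding cycles_on_def by (intro Collect_cong conj_cong refl cyclic_cong) auto

lemma cyclic_on_subset_eq:
  assumes "cyclic_on p A" "cyclic_on p C" "C \<subseteq> A"
  shows "C = A"
proof -
  obtain x where "x \<in> C"
    using assms(2) by (auto simp: cyclic_on_def)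
  then show ?thesis
    using orbit_cyclic_eq3[OF assms(1), of x] orbit_cyclic_eq3[OF assms(2), of x] assms(3) by auto
qed

lemma cyclic_on_subset_invariant:
  assumes "cyclic_on p C" "x \<in> C" "x \<in> A" and A: "\<And>y. y \<in> A \<Longrightarrow> p y \<in> A"
  shows "C \<subseteq> A"
proof
  fix y assume "y \<in> C"
  then have "y \<in> orbit p x"
    using assms(1,2) orbit_cyclic_eq3 by fastforce
  then show "y \<in> A"
    by induction (use assms(3) A in auto)
qed

lemma cycles_on_Un:
  assumes "\<And>y. y \<in> A \<Longrightarrow> p y \<in> A" "\<And>y. y \<in> B \<Longrightarrow> p y \<in> B"
  shows "cycles_on (A \<union> B) p = cycles_on A p \<union> cycles_on B p"
proof -
  have "C \<subseteq> A \<or> C \<subseteq> B" if C: "cyclic_on p C" "C \<subseteq> A \<union> B" for C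
  proof -
    obtain x where "x \<in> C"
      using C(1) by (auto simp: cyclic_on_def)
    then show ?thesis
      using C cyclic_on_subset_invariant[OF C(1)] assms by blast
  qed
  then show ?thesis
    by (auto simp: cycles_on_def)
qed

lemma cycles_on_cyclic: "cyclic_on p A \<Longrightarrow> cycles_on A p = {A}"
  using cyclic_on_subset_eq by (auto simp: cycles_on_def)

section \<open>From compositions to permutations\<close>

text \<open>The offset \<open>a\<close> is the left end of the first interval; it lets inductions over the list of
  parts proceed.\<close>

fun composition_perm :: "nat \<Rightarrow> nat list \<Rightarrow> nat \<Rightarrow> nat" where
  "composition_perm a [] = id"
| "composition_perm a (k # ks) = rotate_down a k \<circ> composition_perm (a + k) ks"

lemma composition_perm_permutes:
  "\<forall>k\<in>set ks. k \<ge> 1 \<Longrightarrow> composition_perm a ks permutes {a..<a + sum_list ks}"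
proof (induction ks arbitrary: a)
  case (Cons k ks)
  have "composition_perm (a + k) ks permutes {a + k..<a + k + sum_list ks}"
    using Cons by simp
  then have "composition_perm (a + k) ks permutes {a..<a + sum_list (k # ks)}"
    by (rule permutes_subset) auto
  moreover have "rotate_down a k permutes {a..<a + sum_list (k # ks)}"
    by (rule permutes_subset[OF rotate_down_permutes]) (use Cons.prems in auto)
  ultimately show ?case
    by (simp only: composition_perm.simps permutes_compose)
qed simp

lemma composition_perm_below:
  assumes "\<forall>k\<in>set ks. k \<ge> 1" "x < a"
  shows "composition_perm a ks x = x"
  using permutes_not_in[OF composition_perm_permutes[OF assms(1), of a], of x] assms(2) by simp

lemma composition_perm_Cons_first:
  assumes "\<forall>k\<in>set ks. k \<ge> 1" "x < a + k"
  shows "composition_perm a (k # ks) x = rotate_down a k x"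
  using composition_perm_below[OF assms] by simp

lemma composition_perm_ge:
  assumes "\<forall>k\<in>set ks. k \<ge> 1" "x \<ge> a"
  shows "composition_perm a ks x \<ge> a"
  using permutes_in_image[OF composition_perm_permutes[OF assms(1), of a], of x]
    permutes_not_in[OF composition_perm_permutes[OF assms(1), of a], of x] assms(2) by fastforce

lemma composition_perm_Cons_rest:
  assumes "\<forall>k\<in>set ks. k \<ge> 1" "k \<ge> 1" "x \<ge> a + k"
  shows "composition_perm a (k # ks) x = composition_perm (a + k) ks x"
  using composition_perm_ge[OF assms(1,3)] assms(2) by (simp add: rotate_down_outside)

lemma composition_perm_unit_descents:
  "\<forall>k\<in>set ks. k \<ge> 1 \<Longrightarrow> x \<le> Suc (composition_perm a ks x)"
proof (induction ks arbitrary: a)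
  case (Cons k ks)
  then have ks: "\<forall>k\<in>set ks. k \<ge> 1" and k: "k \<ge> 1"
    by auto
  show ?case
  proof (cases "x < a + k")
    case True
    have "x \<le> Suc (rotate_down a k x)"
      using k by (auto simp: rotate_down_def)
    then show ?thesis
      using composition_perm_Cons_first[OF ks True] by simp
  next
    case False
    then show ?thesis
      using composition_perm_Cons_rest[OF ks k, of a x] Cons.IH[OF ks] by simp
  qed
qed simp

lemma cycles_on_composition_perm_Cons:
  assumes ks: "\<forall>k\<in>set ks. k \<ge> 1" and k: "k \<ge> 1"
  shows "cycles_on {a..<a + sum_list (k # ks)} (composition_perm a (k # ks)) =
    insert {a..<a + k}
      (cycles_on {a + k..<a + k + sum_list ks} (composition_perm (a + k) ks))"
proof -
  let ?p = "composition_perm a (k # ks)" and ?q = "composition_perm (a + k) ks"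
  let ?A = "{a..<a + k}" and ?B = "{a + k..<a + k + sum_list ks}"
  have pA: "?p x = rotate_down a k x" if "x \<in> ?A" for x
    using composition_perm_Cons_first[OF ks] that by simp
  have pB: "?p x = ?q x" if "x \<in> ?B" for x
    using composition_perm_Cons_rest[OF ks k] that by simp
  have "?p x \<in> ?A" if "x \<in> ?A" for x
    using that permutes_in_image[OF rotate_down_permutes[OF k]] by (simp only: pA)
  moreover have "?p x \<in> ?B" if "x \<in> ?B" for x
    using that permutes_in_image[OF composition_perm_permutes[OF ks]] by (simp only: pB)
  ultimately have "cycles_on (?A \<union> ?B) ?p = cycles_on ?A ?p \<union> cycles_on ?B ?p"
    by (rule cycles_on_Un)
  also have "cycles_on ?A ?p = {?A}"
    using cycles_on_cong[of ?A ?p, OF pA] cycles_on_cyclic[OF rotate_down_cyclic[OF k]] by simp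
  also have "cycles_on ?B ?p = cycles_on ?B ?q"
    by (rule cycles_on_cong[OF pB])
  also have "?A \<union> ?B = {a..<a + sum_list (k # ks)}"
    by auto
  finally show ?thesis
    by (simp only: insert_is_Un[symmetric])
qed

lemma num_cycles_composition_perm:
  "\<forall>k\<in>set ks. k \<ge> 1 \<Longrightarrow>
    num_cycles {a..<a + sum_list ks} (composition_perm a ks) j = count_list ks j"
proof (induction ks arbitrary: a)
  case Nil
  have "cycles_on {} p = {}" for p :: "nat \<Rightarrow> nat"
    by (auto simp: cycles_on_def cyclic_on_def)
  then show ?case
    by (simp add: num_cycles_def)
next
  case (Cons k ks)
  then have ks: "\<forall>k\<in>set ks. k \<ge> 1" and k: "k \<ge> 1"
    by auto
  let ?A = "{a..<a + k}" and ?B = "{a + k..<a + k + sum_list ks}"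
  let ?Z = "cycles_on ?B (composition_perm (a + k) ks)"
  have "?Z \<subseteq> Pow ?B"
    by (auto simp: cycles_on_def)
  then have "finite ?Z" and "?A \<notin> ?Z"
    using k by (auto intro: finite_subset)
  moreover have "{C \<in> insert ?A ?Z. card C = j} =
      (if k = j then insert ?A {C \<in> ?Z. card C = j} else {C \<in> ?Z. card C = j})"
    by auto
  ultimately have "card {C \<in> insert ?A ?Z. card C = j} =
      (if k = j then 1 else 0) + card {C \<in> ?Z. card C = j}"
    by (cases "k = j") (simp_all del: insert_iff)
  then show ?case
    using Cons.IH[OF ks, of "a + k"] cycles_on_composition_perm_Cons[OF ks k, of a]
    by (simp add: num_cycles_def del: composition_perm.simps sum_list.Cons)
qed

text \<open>The least point \<open>a\<close> is sent to the right end of the first interval, which reveals the first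
  part; cancelling the first rotation leaves the permutation of the remaining parts.\<close>

lemma composition_perm_inj:
  assumes "\<forall>k\<in>set ks. k \<ge> 1" "\<forall>k\<in>set ls. k \<ge> 1" "sum_list ks = sum_list ls"
    and "composition_perm a ks = composition_perm a ls"
  shows "ks = ls"
  using assms
proof (induction ks arbitrary: a ls)
  case Nil
  then show ?case
    by (cases ls) auto
next
  case (Cons k ks)
  then obtain l ls' where ls: "ls = l # ls'"
    by (cases ls) auto
  have pos: "\<forall>k\<in>set ks. k \<ge> 1" "k \<ge> 1" "\<forall>k\<in>set ls'. k \<ge> 1" "l \<ge> 1"
    using Cons.prems(1,2) ls by auto
  have "rotate_down a k a = composition_perm a (k # ks) a"
    using pos by (intro composition_perm_Cons_first[symmetric]) auto
  also have "\<dots> = composition_perm a (l # ls') a"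
    using fun_cong[OF Cons.prems(4), of a] ls by simp
  also have "\<dots> = rotate_down a l a"
    using pos by (intro composition_perm_Cons_first) auto
  finally have "rotate_down a k a = rotate_down a l a" .
  then have "k = l"
    using pos by (simp add: rotate_down_def)
  moreover have "inj (rotate_down a k)"
    using rotate_down_permutes[OF pos(2)] permutes_inj by blast
  moreover have "rotate_down a k (composition_perm (a + k) ks x) =
      rotate_down a l (composition_perm (a + l) ls' x)" for x
    using fun_cong[OF Cons.prems(4), of x] ls by simp
  ultimately have "composition_perm (a + k) ks = composition_perm (a + k) ls'"
    by (auto dest: injD)
  then show ?case
    using Cons.IH[OF pos(1,3)] Cons.prems(3) ls \<open>k = l\<close> by simp
qed

section \<open>From permutations to compositions\<close>

text \<open>The preimage of a value \<open>i\<close> with \<open>a \<le> i < \<pi> a\<close> is at most \<open>i + 1\<close>, since descents have size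
  at most one. By induction the points of \<open>{a<..i}\<close> are mapped to smaller values than \<open>i\<close>, and
  \<open>a\<close> is mapped too high, so \<open>i + 1\<close> is the only candidate left.\<close>

lemma unit_descents_first_cycle:
  fixes \<pi> :: "nat \<Rightarrow> nat"
  assumes perm: "\<pi> permutes {a..<a + s}" and desc: "\<And>i. i \<le> Suc (\<pi> i)"
    and "a \<le> i" "i < \<pi> a"
  shows "\<pi> (Suc i) = i"
  using assms(3,4)
proof (induction i rule: less_induct)
  case (less i)
  obtain x where x: "\<pi> x = i"
    using permutes_surj[OF perm] by (metis surjD)
  have "x \<ge> a"
    using x less.prems(1) permutes_not_in[OF perm, of x] by fastforce
  moreover have "x \<noteq> a"
    using x less.prems(2) by auto
  moreover have "x \<le> Suc i"
    using desc[of x] x by simp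
  moreover have False if "a < x" "x \<le> i"
  proof -
    have "x - 1 < i" "a \<le> x - 1" "Suc (x - 1) = x"
      using that by auto
    then show False
      using less.IH[of "x - 1"] less.prems(2) x by simp
  qed
  ultimately have "x = Suc i"
    by force
  then show ?case
    using x by simp
qed

lemma composition_perm_surj:
  fixes \<pi> :: "nat \<Rightarrow> nat"
  assumes "\<pi> permutes {a..<a + s}" "\<And>i. i \<le> Suc (\<pi> i)"
  shows "\<exists>ks. (\<forall>k\<in>set ks. k \<ge> 1) \<and> sum_list ks = s \<and> composition_perm a ks = \<pi>"
  using assms
proof (induction s arbitrary: a \<pi> rule: less_induct)
  case (less s)
  show ?case
  proof (cases "s = 0")
    case True
    then show ?thesis
      using less.prems(1) by (intro exI[of _ "[]"]) simp
  next
    case False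
    define k where "k = Suc (\<pi> a - a)"
    have "\<pi> a \<in> {a..<a + s}"
      using False permutes_in_image[OF less.prems(1)] by simp
    then have pa: "\<pi> a = a + k - 1" and k: "k \<ge> 1" "k \<le> s"
      by (auto simp: k_def)
    let ?r = "rotate_down a k"
    have r: "?r permutes {a..<a + k}"
      using k(1) by (rule rotate_down_permutes)
    have first: "\<pi> x = ?r x" if "x \<in> {a..<a + k}" for x
    proof (cases "x = a")
      case True
      then show ?thesis
        using pa by (simp add: rotate_down_def)
    next
      case False
      then have "a \<le> x - 1" "x - 1 < \<pi> a"
        using that pa by auto
      from unit_descents_first_cycle[OF less.prems this] show ?thesis
        using False that by (simp add: rotate_down_def)
    qed
    \<comment> \<open>Undoing the first cycle leaves a permutation of the points to its right.\<close>
    define \<sigma> where "\<sigma> = inv ?r \<circ> \<pi>"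
    have \<pi>: "\<pi> = ?r \<circ> \<sigma>"
      using permutes_inv_o(1)[OF r] by (simp add: \<sigma>_def o_assoc)
    have "inv ?r permutes {a..<a + s}"
      by (rule permutes_subset[OF permutes_inv[OF r]]) (use k in auto)
    then have "\<sigma> permutes {a..<a + s}"
      unfolding \<sigma>_def by (rule permutes_compose[OF less.prems(1)])
    moreover have "\<sigma> x = x" if "x \<in> {a..<a + s} - {a + k..<a + k + (s - k)}" for x
      using k that by (auto simp: \<sigma>_def first permutes_inverses(2)[OF r])
    ultimately have \<sigma>: "\<sigma> permutes {a + k..<a + k + (s - k)}"
      by (rule permutes_superset)
    have "i \<le> Suc (\<sigma> i)" for i
    proof (cases "i \<in> {a + k..<a + k + (s - k)}")
      case True
      then have "\<sigma> i \<ge> a + k"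
        using permutes_in_image[OF \<sigma>, of i] by simp
      then have "\<pi> i = \<sigma> i"
        using k(1) by (simp add: \<pi> rotate_down_outside)
      then show ?thesis
        using less.prems(2)[of i] by simp
    next
      case False
      then show ?thesis
        using permutes_not_in[OF \<sigma>] by simp
    qed
    then obtain ks where "\<forall>k\<in>set ks. k \<ge> 1" "sum_list ks = s - k"
        "composition_perm (a + k) ks = \<sigma>"
      using less.IH[OF _ \<sigma>] k False by auto
    then show ?thesis
      using k by (intro exI[of _ "k # ks"]) (auto simp: \<pi>)
  qed
qed

section \<open>The bijection\<close>

theorem lemma2p5:
  fixes n :: nat
  assumes "n \<ge> 1"
  shows "\<exists>f. bij_betw f
           {\<pi>. \<pi> permutes {1..n} \<and> (\<forall>i\<in>{2..n}. \<pi> i \<ge> i - 1)}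
           (compositions n) \<and>
         (\<forall>\<pi>. \<pi> permutes {1..n} \<longrightarrow> (\<forall>i\<in>{2..n}. \<pi> i \<ge> i - 1) \<longrightarrow>
           (\<forall>k\<ge>1. num_cycles {1..n} \<pi> k = count_list (f \<pi>) k))"
proof -
  let ?P = "{\<pi>. \<pi> permutes {1..n} \<and> (\<forall>i\<in>{2..n}. \<pi> i \<ge> i - 1)}"
  let ?g = "composition_perm 1"
  have ivl: "{1..n} = {1..<1 + n}"
    by auto
  have "?g c \<in> ?P" if "c \<in> compositions n" for c
  proof -
    have "?g c permutes {1..n}"
      using that composition_perm_permutes[of c 1] by (simp add: compositions_def ivl del: One_nat_def)
    moreover have "i - 1 \<le> ?g c i" for i
      using that composition_perm_unit_descents[of c i 1] by (simp add: compositions_def)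
    ultimately show ?thesis
      by blast
  qed
  moreover have "\<pi> \<in> ?g ` compositions n" if "\<pi> \<in> ?P" for \<pi>
  proof -
    \<comment> \<open>Fixed points and the point 1 satisfy the descent condition trivially.\<close>
    have "i \<le> Suc (\<pi> i)" for i
    proof (cases "i \<in> {2..n}")
      case True
      then have "\<pi> i \<ge> i - 1"
        using that by blast
      then show ?thesis
        by simp
    next
      case False
      then have "i \<le> 1 \<or> \<pi> i = i"
        using that by (auto simp: permutes_not_in)
      then show ?thesis
        by auto
    qed
    moreover have "\<pi> permutes {1..<1 + n}"
      using that by (simp add: ivl del: One_nat_def)
    ultimately show ?thesis
      using composition_perm_surj[of \<pi> 1 n] by (auto simp: compositions_def)
  qed
  moreover have "inj_on ?g (compositions n)"
    using composition_perm_inj by (auto intro!: inj_onI simp: compositions_def)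
  ultimately have g: "bij_betw ?g (compositions n) ?P"
    unfolding bij_betw_def by blast
  let ?f = "inv_into (compositions n) ?g"
  have "num_cycles {1..n} \<pi> k = count_list (?f \<pi>) k" if "\<pi> \<in> ?P" for \<pi> k
  proof -
    have "?f \<pi> \<in> compositions n" "?g (?f \<pi>) = \<pi>"
      using that g by (auto simp: bij_betw_def intro: inv_into_into f_inv_into_f)
    then show ?thesis
      using num_cycles_composition_perm[of "?f \<pi>" 1 k]
      by (simp add: compositions_def ivl del: One_nat_def)
  qed
  then show ?thesis
    using bij_betw_inv_into[OF g] by blast
qed

end
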